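(* Let $B$ be a perfect skew brace, i.e. $B=[B,B]^B$. Then $\operatorname{Z}_2(B)=\operatorname{Z}(B)$ if and only if for every $z\in \operatorname{Z}_2(B)$ the multiplicative conjugation map $B\to B$, $x\mapsto zxz^{-1}$, is an automorphism of the additive group $(B,+)$. In particular, if $B$ is a two-sided perfect skew brace, then $\operatorname{Z}(B/\operatorname{Z}(B))$ is trivial (it consists only of the identity element).
   Context: A skew (left) brace $(B,+,\cdot)$ is a set $B$ with two group structures $(B,+)$ and $(B,\cdot)$ (neither assumed abelian or finite) such that $a(b+c)=ab-a+ac$ for all $a,b,c\in B$; the two groups share the identity element $0$. It is two-sided if moreover $(b+c)a=ba-a+ca$ for all $a,b,c\in B$. Put $a*b=-a+ab-b$ and $\lambda_a(b)=-a+ab$; $a\mapsto\lambda_a$ is a homomorphism $(B,\cdot)\to\operatorname{Aut}(B,+)$. For $X,Y\subseteq B$, $X*Y$ is the subgroup of $(B,+)$ generated by $\{x*y\mid x\in X,y\in Y\}$, and $[X,Y]_+$, $[X,Y]_\bullet$ are the commutator subgroups of $X$ and $Y$ in $(B,+)$ and $(B,\cdot)$, respectively. A subbrace is a subset that is a subgroup of both $(B,+)$ and $(B,\cdot)$. An ideal is a subbrace $I$ with $(I,+)$ normal in $(B,+)$, $B*I\subseteq I$ and $I*B\subseteq I$; then the quotient skew brace $B/I$ is defined. $\langle X\rangle^B$ is the smallest ideal of $B$ containing $X$. For ideals $I,J$, $[I,J]^B=\langle [I,J]_+\cup[I,J]_\bullet\cup\{ij-(i+j)\mid i\in I,j\in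 J\}\rangle^B$; the derived ideal of $B$ is $[B,B]^B$. $\ker\lambda=\{a\in B\mid \lambda_a(b)=b\ \forall b\in B\}$, and the centre is the ideal $\operatorname{Z}(B)=\ker\lambda\cap \operatorname{Z}(B,+)\cap \operatorname{Z}(B,\cdot)$, where $\operatorname{Z}(B,+)$ and $\operatorname{Z}(B,\cdot)$ are the centres of the two groups. The upper central series is $\operatorname{Z}_0(B)=0$, $\operatorname{Z}_{n+1}(B)/\operatorname{Z}_n(B)=\operatorname{Z}(B/\operatorname{Z}_n(B))$; so $\operatorname{Z}_1(B)=\operatorname{Z}(B)$. *)

theory Defs
  imports "HOL-Algebra.QuotRing" "HOL-Algebra.Generated_Groups"
begin

text \<open>
  Skew braces use the record type of rings: \<open>mult\<close> and \<open>one\<close> give the group \<open>(B,\<cdot>)\<close> and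
  \<open>add\<close> and \<open>zero\<close> give \<open>(B,+)\<close>, i.e. \<^term>\<open>add_monoid B\<close>. Neither group is assumed
  abelian. That the two identities agree is a consequence of the axioms.
\<close>

locale skew_brace =
  fixes B (structure)
  assumes add_group: "group (add_monoid B)"
    and mult_group: "group B"
    and left_distrib:
      "\<lbrakk>a \<in> carrier B; b \<in> carrier B; c \<in> carrier B\<rbrakk>
        \<Longrightarrow> a \<otimes> (b \<oplus> c) = a \<otimes> b \<ominus> a \<oplus> a \<otimes> c"

lemma (in skew_brace) zero_eq_one: "\<zero> = \<one>"
proof -
  interpret A: group "add_monoid B" by (rule add_group)
  interpret M: group B by (rule mult_group)
  have [simp]: "\<zero> \<in> carrier B" using A.one_closed by simp
  have "\<one> \<otimes> (\<zero> \<oplus> \<zero>) = \<one> \<otimes> \<zero> \<ominus> \<one> \<oplus> \<one> \<otimes> \<zero>"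
    by (rule left_distrib) auto
  moreover have "\<zero> \<oplus> x = x" "x \<oplus> \<zero> = x" if "x \<in> carrier B" for x
    using A.l_one A.r_one that by simp_all
  moreover have inv1: "\<ominus> \<one> \<in> carrier B" "\<ominus> \<one> \<oplus> \<one> = \<zero>"
    using A.inv_closed[of \<one>] A.l_inv[of \<one>] by (simp_all add: a_inv_def)
  ultimately have "\<zero> = \<ominus> \<one>" by (simp add: a_minus_def)
  with inv1 \<open>\<And>x. x \<in> carrier B \<Longrightarrow> \<zero> \<oplus> x = x\<close> show ?thesis by force
qed

locale two_sided_skew_brace = skew_brace +
  assumes right_distrib:
      "\<lbrakk>a \<in> carrier B; b \<in> carrier B; c \<in> carrier B\<rbrakk>
        \<Longrightarrow> (b \<oplus> c) \<otimes> a = b \<otimes> a \<ominus> a \<oplus> c \<otimes> a"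

definition brace_lambda :: "('a, 'm) ring_scheme \<Rightarrow> 'a \<Rightarrow> 'a \<Rightarrow> 'a"
  where "brace_lambda B a b = \<ominus>\<^bsub>B\<^esub> a \<oplus>\<^bsub>B\<^esub> a \<otimes>\<^bsub>B\<^esub> b"

definition brace_star :: "('a, 'm) ring_scheme \<Rightarrow> 'a \<Rightarrow> 'a \<Rightarrow> 'a"
  where "brace_star B a b = \<ominus>\<^bsub>B\<^esub> a \<oplus>\<^bsub>B\<^esub> a \<otimes>\<^bsub>B\<^esub> b \<ominus>\<^bsub>B\<^esub> b"

definition star_subgroup :: "('a, 'm) ring_scheme \<Rightarrow> 'a set \<Rightarrow> 'a set \<Rightarrow> 'a set"
  where "star_subgroup B X Y =
    generate (add_monoid B) {brace_star B x y | x y. x \<in> X \<and> y \<in> Y}"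

text \<open>Two-set version of \<^const>\<open>derived\<close>, with the same convention for commutators.\<close>

definition commutator_subgroup :: "('a, 'm) monoid_scheme \<Rightarrow> 'a set \<Rightarrow> 'a set \<Rightarrow> 'a set"
  where "commutator_subgroup G X Y =
    generate G {x \<otimes>\<^bsub>G\<^esub> y \<otimes>\<^bsub>G\<^esub> inv\<^bsub>G\<^esub> x \<otimes>\<^bsub>G\<^esub> inv\<^bsub>G\<^esub> y | x y. x \<in> X \<and> y \<in> Y}"

definition group_centre :: "('a, 'm) monoid_scheme \<Rightarrow> 'a set"
  where "group_centre G =
    {z \<in> carrier G. \<forall>x \<in> carrier G. z \<otimes>\<^bsub>G\<^esub> x = x \<otimes>\<^bsub>G\<^esub> z}"

definition subbrace :: "'a set \<Rightarrow> ('a, 'm) ring_scheme \<Rightarrow> bool"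
  where "subbrace S B \<longleftrightarrow> subgroup S (add_monoid B) \<and> subgroup S B"

definition brace_ideal :: "'a set \<Rightarrow> ('a, 'm) ring_scheme \<Rightarrow> bool"
  where "brace_ideal I B \<longleftrightarrow>
    subbrace I B \<and> I \<lhd> add_monoid B \<and>
    star_subgroup B (carrier B) I \<subseteq> I \<and> star_subgroup B I (carrier B) \<subseteq> I"

definition gen_brace_ideal :: "('a, 'm) ring_scheme \<Rightarrow> 'a set \<Rightarrow> 'a set"
  where "gen_brace_ideal B X = \<Inter>{I. brace_ideal I B \<and> X \<subseteq> I}"

definition ideal_commutator :: "('a, 'm) ring_scheme \<Rightarrow> 'a set \<Rightarrow> 'a set \<Rightarrow> 'a set"
  where "ideal_commutator B I J = gen_brace_ideal B
    (commutator_subgroup (add_monoid B) I J \<union> commutator_subgroup B I J \<union>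
     {i \<otimes>\<^bsub>B\<^esub> j \<ominus>\<^bsub>B\<^esub> (i \<oplus>\<^bsub>B\<^esub> j) | i j. i \<in> I \<and> j \<in> J})"

definition perfect_brace :: "('a, 'm) ring_scheme \<Rightarrow> bool"
  where "perfect_brace B \<longleftrightarrow> carrier B = ideal_commutator B (carrier B) (carrier B)"

definition lambda_kernel :: "('a, 'm) ring_scheme \<Rightarrow> 'a set"
  where "lambda_kernel B = {a \<in> carrier B. \<forall>b \<in> carrier B. brace_lambda B a b = b}"

definition brace_centre :: "('a, 'm) ring_scheme \<Rightarrow> 'a set"
  where "brace_centre B = lambda_kernel B \<inter> group_centre (add_monoid B) \<inter> group_centre B"

text \<open>
  The quotient of a skew brace by an ideal \<open>I\<close> is the library's \<^term>\<open>B Quot I\<close>: its elements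
  are the additive cosets \<open>I + a\<close>, which are also the multiplicative cosets \<open>a \<cdot> I\<close>, with
  \<open>(I + a) + (I + b) = I + (a + b)\<close> and \<open>(I + a) \<cdot> (I + b) = I + a \<cdot> b\<close>. The equation
  \<open>Z\<^sub>n\<^sub>+\<^sub>1 / Z\<^sub>n = Z(B / Z\<^sub>n)\<close> is solved for \<open>Z\<^sub>n\<^sub>+\<^sub>1\<close> by taking the preimage under the
  projection.
\<close>

primrec upper_central :: "('a, 'm) ring_scheme \<Rightarrow> nat \<Rightarrow> 'a set"
  where
    "upper_central B 0 = {\<zero>\<^bsub>B\<^esub>}"
  | "upper_central B (Suc n) =
      {x \<in> carrier B. upper_central B n +>\<^bsub>B\<^esub> x \<in> brace_centre (B Quot upper_central B n)}"

end

theory Submission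
  imports Defs
begin

text \<open>
  The proof is a skew brace version of Gruen's lemma on perfect groups. An element \<open>z\<close> of
  \<open>Z\<^sub>2(B)\<close> satisfies every equation that defines the centre up to an error term in \<open>Z(B)\<close>:
  \<^item> \<open>z b = f b + b z\<close>,
  \<^item> \<open>z + b = \<alpha> b + (b + z)\<close>,
  \<^item> \<open>z b = \<sigma> b + (z + b)\<close>.

  In group theory the single error term is a homomorphism into the centre, so a perfect group
  kills it. A perfect skew brace kills only those maps that are homomorphisms of both groups at
  once, because it is the kernel of such a map that is an ideal containing the derived ideal
  (\<open>perfect_hom_trivial\<close>). None of the three error terms has this property for free: \<open>f\<close> is
  multiplicative, whereas \<open>\<alpha>\<close> and \<open>\<sigma>\<close> are additive.

  Additivity of the conjugation \<open>b \<mapsto> z b z\<^sup>-\<^sup>1 = f b + b\<close> amounts to additivity of \<open>f\<close>, so it gives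
  \<open>f = 0\<close> and \<open>z b = b z\<close>. From here the other two error terms fall in turn, seen through the
  maps \<open>\<lambda>\<^sub>b\<close>:
  \<^item> Combining the equations, \<open>b z = \<tau> b + (b + z)\<close> for the additive map \<open>\<tau> = \<sigma> + \<alpha>\<close>. This says
    \<open>\<lambda>\<^sub>b(z) = \<tau> b + z\<close>. Since \<open>\<lambda>\<close> is an action that fixes central elements, \<open>\<tau>\<close> is also
    multiplicative, hence \<open>\<tau> = 0\<close> and every \<open>\<lambda>\<^sub>b\<close> fixes \<open>z\<close>.
  \<^item> Now \<open>\<alpha> c\<close>, the additive commutator of \<open>z\<close> and \<open>c\<close>, equals that of \<open>z\<close> and \<open>\<lambda>\<^sub>b(c)\<close>,
    because the additive automorphism \<open>\<lambda>\<^sub>b\<close> fixes both \<open>z\<close> and the central element \<open>\<alpha> c\<close>. As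
    \<open>b c = b + \<lambda>\<^sub>b(c)\<close>, the additive map \<open>\<alpha>\<close> is multiplicative, hence \<open>\<alpha> = 0\<close> and
    \<open>\<sigma> = \<tau> - \<alpha> = 0\<close>.

  Thus \<open>z\<close> is central (\<open>second_centre_additive_conj_central\<close>). Conversely, conjugation by a
  central element is the identity. In a two-sided skew brace every multiplicative conjugation is
  additive (\<open>conj_additive\<close>), so \<open>Z\<^sub>2(B) = Z(B)\<close>, which says that \<open>B/Z(B)\<close> has trivial centre.
\<close>

section \<open>The centre of a skew brace\<close>

sublocale skew_brace \<subseteq> mult: group B
  by (rule mult_group)

sublocale skew_brace \<subseteq> add: group "add_monoid B"
  rewrites "carrier (add_monoid B) = carrier B"
    and "mult (add_monoid B) = add B"
    and "one (add_monoid B) = zero B"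
    and "m_inv (add_monoid B) = a_inv B"
    and "r_coset (add_monoid B) = a_r_coset B"
  by (simp_all add: add_group a_inv_def a_r_coset_def)

text \<open>
  Solving \<open>\<lambda>\<^sub>x(b) = - x + x b = b\<close> for \<open>x b\<close> takes place in the additive group. So the criterion
  applies to quotients as well, without a proof that they are skew braces.
\<close>

lemma mem_brace_centre_iff:
  assumes add: "group (add_monoid Q)"
    and closed: "mult Q \<in> carrier Q \<rightarrow> carrier Q \<rightarrow> carrier Q"
  shows "x \<in> brace_centre Q \<longleftrightarrow> x \<in> carrier Q \<and> (\<forall>b \<in> carrier Q.
      x \<otimes>\<^bsub>Q\<^esub> b = x \<oplus>\<^bsub>Q\<^esub> b \<and> x \<oplus>\<^bsub>Q\<^esub> b = b \<oplus>\<^bsub>Q\<^esub> x \<and> x \<otimes>\<^bsub>Q\<^esub> b = b \<otimes>\<^bsub>Q\<^esub> x)"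
proof -
  interpret A: group "add_monoid Q" by (rule add)
  have "brace_lambda Q x b = b \<longleftrightarrow> x \<otimes>\<^bsub>Q\<^esub> b = x \<oplus>\<^bsub>Q\<^esub> b"
    if "x \<in> carrier Q" "b \<in> carrier Q" for b
    using A.inv_solve_left[of b x "x \<otimes>\<^bsub>Q\<^esub> b"] that funcset_mem[OF funcset_mem[OF closed]]
    by (auto simp: brace_lambda_def a_inv_def)
  then show ?thesis
    by (auto simp: brace_centre_def lambda_kernel_def group_centre_def)
qed

context skew_brace
begin

lemma zero_mult [simp]:
  assumes "b \<in> carrier B"
  shows "\<zero> \<otimes> b = b" "b \<otimes> \<zero> = b"
  using assms by (simp_all add: zero_eq_one)

lemma mem_centre_iff:
  "z \<in> brace_centre B \<longleftrightarrow> z \<in> carrier B \<and>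
    (\<forall>b \<in> carrier B. z \<otimes> b = z \<oplus> b \<and> z \<oplus> b = b \<oplus> z \<and> z \<otimes> b = b \<otimes> z)"
  by (rule mem_brace_centre_iff[OF add_group]) simp

lemma brace_centreI:
  assumes "z \<in> carrier B"
    and "\<And>b. b \<in> carrier B \<Longrightarrow> z \<otimes> b = z \<oplus> b"
    and "\<And>b. b \<in> carrier B \<Longrightarrow> z \<oplus> b = b \<oplus> z"
    and "\<And>b. b \<in> carrier B \<Longrightarrow> z \<otimes> b = b \<otimes> z"
  shows "z \<in> brace_centre B"
  using assms by (auto simp: mem_centre_iff)

lemma brace_centreD:
  assumes "z \<in> brace_centre B"
  shows "z \<in> carrier B"
    and "b \<in> carrier B \<Longrightarrow> z \<otimes> b = z \<oplus> b"
    and "b \<in> carrier B \<Longrightarrow> z \<oplus> b = b \<oplus> z"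
    and "b \<in> carrier B \<Longrightarrow> z \<otimes> b = b \<otimes> z"
  using assms by (auto simp: mem_centre_iff)

text \<open>
  The next three rules move a central summand to the front of any expression. They hold because
  adding a central element is the same as multiplying by it.
\<close>

lemma central_add_left_commute:
  assumes "z \<in> brace_centre B" "b \<in> carrier B" "c \<in> carrier B"
  shows "b \<oplus> (z \<oplus> c) = z \<oplus> (b \<oplus> c)"
  using add.m_assoc[of b z c] add.m_assoc[of z b c] brace_centreD(1,3)[OF assms(1)] assms(2,3)
  by simp

lemma central_mult_left_commute:
  assumes "z \<in> brace_centre B" "b \<in> carrier B" "c \<in> carrier B"
  shows "b \<otimes> (z \<oplus> c) = z \<oplus> b \<otimes> c"
proof -
  note z = brace_centreD[OF assms(1)]
  have "b \<otimes> (z \<oplus> c) = b \<otimes> z \<otimes> c"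
    using z(1) z(2)[OF assms(3)] assms(2,3) by (simp add: mult.m_assoc)
  also have "\<dots> = z \<otimes> (b \<otimes> c)"
    using z(1) assms(2,3) by (simp add: mult.m_assoc flip: z(4)[OF assms(2)])
  finally show ?thesis using z(2) assms(2,3) by simp
qed

lemma central_mult_right:
  assumes "z \<in> brace_centre B" "b \<in> carrier B" "c \<in> carrier B"
  shows "(z \<oplus> b) \<otimes> c = z \<oplus> b \<otimes> c"
proof -
  note z = brace_centreD[OF assms(1)]
  have "(z \<oplus> b) \<otimes> c = z \<otimes> (b \<otimes> c)"
    using z(1) assms(2,3) by (simp add: mult.m_assoc flip: z(2)[OF assms(2)])
  then show ?thesis using z(2) assms(2,3) by simp
qed

lemma brace_centre_add_subgroup: "subgroup (brace_centre B) (add_monoid B)"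
proof (rule group.subgroupI[OF add_group], simp_all flip: a_inv_def)
  show "brace_centre B \<subseteq> carrier B" by (auto dest: brace_centreD(1))
  have "\<zero> \<in> brace_centre B"
    by (rule brace_centreI) simp_all
  then show "brace_centre B \<noteq> {}" by auto
next
  fix z assume z: "z \<in> brace_centre B"
  note zc = brace_centreD[OF z]
  have nc: "\<ominus> z \<in> carrier B" using zc by simp
  have comm: "\<ominus> z \<oplus> b = b \<oplus> \<ominus> z" if b: "b \<in> carrier B" for b
  proof -
    have "z \<oplus> (b \<oplus> \<ominus> z) = b \<oplus> (z \<oplus> \<ominus> z)"
      using central_add_left_commute[OF z b nc] by simp
    also have "\<dots> = b" using zc(1) b by simp
    finally show ?thesis
      using add.inv_solve_left[of "b \<oplus> \<ominus> z" z b] zc(1) nc b by simp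
  qed
  have lin: "\<ominus> z \<otimes> b = \<ominus> z \<oplus> b" if "b \<in> carrier B" for b
  proof -
    have "z \<oplus> \<ominus> z \<otimes> b = (z \<oplus> \<ominus> z) \<otimes> b"
      using central_mult_right[OF z nc that] by simp
    also have "\<dots> = b" using zc(1) that by simp
    finally show ?thesis using add.inv_solve_left[of "\<ominus> z \<otimes> b" z b] zc(1) nc that by simp
  qed
  have rin: "b \<otimes> \<ominus> z = \<ominus> z \<oplus> b" if "b \<in> carrier B" for b
  proof -
    have "z \<oplus> b \<otimes> \<ominus> z = b \<otimes> (z \<oplus> \<ominus> z)"
      using central_mult_left_commute[OF z that nc] by simp
    also have "\<dots> = b" using zc(1) that by simp
    finally show ?thesis using add.inv_solve_left[of "b \<otimes> \<ominus> z" z b] zc(1) nc that by simp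
  qed
  show "\<ominus> z \<in> brace_centre B"
    by (rule brace_centreI) (simp_all add: nc comm lin rin)
next
  fix z w assume z: "z \<in> brace_centre B" and w: "w \<in> brace_centre B"
  note zc = brace_centreD[OF z] and wc = brace_centreD[OF w]
  show "z \<oplus> w \<in> brace_centre B"
  proof (rule brace_centreI)
    fix b assume b: "b \<in> carrier B"
    show "(z \<oplus> w) \<otimes> b = z \<oplus> w \<oplus> b"
      using b zc(1) wc(1) wc(2)[OF b] central_mult_right[OF z wc(1) b] by (simp add: add.m_assoc)
    show "(z \<oplus> w) \<oplus> b = b \<oplus> (z \<oplus> w)"
      using b zc(1) wc(1) wc(3)[OF b] central_add_left_commute[OF z b wc(1)]
      by (simp add: add.m_assoc)
    show "(z \<oplus> w) \<otimes> b = b \<otimes> (z \<oplus> w)"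
      using wc(4)[OF b] central_mult_right[OF z wc(1) b] central_mult_left_commute[OF z b wc(1)]
      by simp
  next show "z \<oplus> w \<in> carrier B" using zc(1) wc(1) by simp
  qed
qed

section \<open>Perfect skew braces have no nontrivial abelian images\<close>

text \<open>
  The kernel is an ideal. Since \<open>A\<close> is abelian and carries the images of both operations, the
  kernel contains all commutators of either kind and all differences \<open>i j - (i + j)\<close>, hence the
  derived ideal.
\<close>

lemma perfect_hom_trivial:
  assumes perfect: "perfect_brace B"
    and comm: "comm_group A"
    and add_hom: "f \<in> hom (add_monoid B) A"
    and mult_hom: "f \<in> hom B A"
    and x: "x \<in> carrier B"
  shows "f x = \<one>\<^bsub>A\<^esub>"
proof -
  interpret A: comm_group A by (rule comm)
  interpret fa: group_hom "add_monoid B" A f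
    using add_hom add_group A.is_group by (simp add: group_hom_def group_hom_axioms_def)
  interpret fm: group_hom B A f
    using mult_hom mult_group A.is_group by (simp add: group_hom_def group_hom_axioms_def)
  define K where "K = kernel B A f"
  have K_add: "K = kernel (add_monoid B) A f" by (simp add: K_def kernel_def)
  have K_mem: "y \<in> K \<longleftrightarrow> y \<in> carrier B \<and> f y = \<one>\<^bsub>A\<^esub>" for y
    by (auto simp: K_def kernel_def)
  have closed: "f y \<in> carrier A" if "y \<in> carrier B" for y
    using that by simp
  have add: "f (y \<oplus> w) = f y \<otimes>\<^bsub>A\<^esub> f w" if "y \<in> carrier B" "w \<in> carrier B" for y w
    using fa.hom_mult[of y w] that by simp
  have minus: "f (\<ominus> y) = inv\<^bsub>A\<^esub> f y" if "y \<in> carrier B" for y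
    using fa.hom_inv[of y] that by (simp add: a_inv_def)
  have sub_add: "subgroup K (add_monoid B)" and normal: "K \<lhd> add_monoid B"
    unfolding K_add by (rule fa.subgroup_kernel fa.normal_kernel)+
  have sub_mult: "subgroup K B" unfolding K_def by (rule fm.subgroup_kernel)
  have conj: "u \<otimes>\<^bsub>A\<^esub> v \<otimes>\<^bsub>A\<^esub> inv\<^bsub>A\<^esub> u = v" if "u \<in> carrier A" "v \<in> carrier A" for u v
    unfolding A.m_comm[OF that] using that by (simp add: A.m_assoc)
  have star: "brace_star B a b \<in> K" if "a \<in> carrier B" "b \<in> carrier B" for a b
  proof -
    have "f (brace_star B a b) = inv\<^bsub>A\<^esub> f a \<otimes>\<^bsub>A\<^esub> (f a \<otimes>\<^bsub>A\<^esub> f b) \<otimes>\<^bsub>A\<^esub> inv\<^bsub>A\<^esub> f b"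
      using that by (simp add: brace_star_def a_minus_def add minus)
    also have "\<dots> = \<one>\<^bsub>A\<^esub>" using closed[OF that(1)] closed[OF that(2)] by (simp flip: A.m_assoc)
    finally show ?thesis using that by (simp add: K_mem brace_star_def a_minus_def)
  qed
  have ideal: "brace_ideal K B"
    unfolding brace_ideal_def subbrace_def star_subgroup_def
  proof (intro conjI sub_add sub_mult normal)
    show "generate (add_monoid B) {brace_star B x y |x y. x \<in> carrier B \<and> y \<in> K} \<subseteq> K"
      by (rule group.generate_subgroup_incl[OF add_group _ sub_add]) (use star K_mem in blast)
    show "generate (add_monoid B) {brace_star B x y |x y. x \<in> K \<and> y \<in> carrier B} \<subseteq> K"
      by (rule group.generate_subgroup_incl[OF add_group _ sub_add]) (use star K_mem in blast)
  qed
  have add_comm: "x \<oplus> y \<oplus> \<ominus> x \<oplus> \<ominus> y \<in> K" if "x \<in> carrier B" "y \<in> carrier B" for x y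
    using that conj[of "f x" "f y"] by (simp add: K_mem add minus)
  have mult_comm: "x \<otimes> y \<otimes> inv x \<otimes> inv y \<in> K" if "x \<in> carrier B" "y \<in> carrier B" for x y
    using that conj[of "f x" "f y"] by (simp add: K_mem)
  have "commutator_subgroup (add_monoid B) (carrier B) (carrier B) \<subseteq> K"
    unfolding commutator_subgroup_def
    by (rule group.generate_subgroup_incl[OF add_group _ sub_add])
       (auto simp flip: a_inv_def intro!: add_comm)
  moreover have "commutator_subgroup B (carrier B) (carrier B) \<subseteq> K"
    unfolding commutator_subgroup_def
    by (rule mult.generate_subgroup_incl[OF _ sub_mult]) (auto intro!: mult_comm)
  moreover have "i \<otimes> j \<ominus> (i \<oplus> j) \<in> K" if "i \<in> carrier B" "j \<in> carrier B" for i j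
    using that by (simp add: K_mem a_minus_def add minus)
  then have "{i \<otimes> j \<ominus> (i \<oplus> j) | i j. i \<in> carrier B \<and> j \<in> carrier B} \<subseteq> K"
    by blast
  ultimately have "ideal_commutator B (carrier B) (carrier B) \<subseteq> K"
    unfolding ideal_commutator_def gen_brace_ideal_def using ideal by (intro Inter_lower) simp
  with perfect x show ?thesis
    by (auto simp: perfect_brace_def K_mem)
qed

text \<open>
  The two operations agree on the centre, so one abelian group serves as target for both laws.
\<close>

lemma perfect_central_map_zero:
  assumes perfect: "perfect_brace B"
    and central: "\<And>b. b \<in> carrier B \<Longrightarrow> f b \<in> brace_centre B"
    and add: "\<And>b c. \<lbrakk>b \<in> carrier B; c \<in> carrier B\<rbrakk> \<Longrightarrow> f (b \<oplus> c) = f b \<oplus> f c"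
    and mult: "\<And>b c. \<lbrakk>b \<in> carrier B; c \<in> carrier B\<rbrakk> \<Longrightarrow> f (b \<otimes> c) = f b \<oplus> f c"
    and b: "b \<in> carrier B"
  shows "f b = \<zero>"
proof -
  let ?A = "(add_monoid B)\<lparr>carrier := brace_centre B\<rparr>"
  have "group ?A"
    by (rule subgroup.subgroup_is_group[OF brace_centre_add_subgroup add_group])
  then have "comm_group ?A"
    by (rule group.group_comm_groupI) (simp add: brace_centreD(1,3))
  moreover have "f \<in> hom (add_monoid B) ?A" "f \<in> hom B ?A"
    using central add mult by (auto simp: hom_def)
  ultimately show ?thesis
    using perfect_hom_trivial[OF perfect _ _ _ b] by force
qed

section \<open>Quotients by central subgroups\<close>

lemma zero_subgroup_central: "subgroup {\<zero>} (add_monoid B)" "{\<zero>} \<subseteq> brace_centre B"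
proof -
  show "subgroup {\<zero>} (add_monoid B)" using add.triv_subgroup by simp
  show "{\<zero>} \<subseteq> brace_centre B"
    using subgroup.one_closed[OF brace_centre_add_subgroup] by simp
qed

context
  fixes I
  assumes I_sub: "subgroup I (add_monoid B)" and I_central: "I \<subseteq> brace_centre B"
begin

lemma central_subgroup_normal: "I \<lhd> add_monoid B"
proof -
  have "x \<oplus> h \<oplus> \<ominus> x \<in> I" if x: "x \<in> carrier B" and h: "h \<in> I" for x h
  proof -
    have hc: "h \<in> brace_centre B" using h I_central by auto
    note h' = brace_centreD[OF hc]
    have "x \<oplus> h \<oplus> \<ominus> x = h"
      using h'(1) h'(3)[OF x, symmetric] x by (simp add: add.m_assoc)
    then show ?thesis using h by simp
  qed
  then show ?thesis using add.normal_inv_iff I_sub by blast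
qed

text \<open>
  Multiplication of cosets is well defined since \<open>(i + x)(j + y) = (i + j) + x y\<close> for central
  \<open>i\<close> and \<open>j\<close>.
\<close>

lemma central_coset_mult:
  assumes x: "x \<in> carrier B" and y: "y \<in> carrier B"
  shows "rcoset_mult B I (I +> x) (I +> y) = I +> x \<otimes> y"
proof -
  have "I +> a \<otimes> b = I +> x \<otimes> y" if a: "a \<in> I +> x" and b: "b \<in> I +> y" for a b
  proof -
    from a b obtain i j where i: "i \<in> I" "a = i \<oplus> x" and j: "j \<in> I" "b = j \<oplus> y"
      by (auto simp: a_r_coset_def')
    have ij: "i \<in> brace_centre B" "j \<in> brace_centre B" using i j I_central by auto
    note carr = ij[THEN brace_centreD(1)]
    have "a \<otimes> b = i \<oplus> (j \<oplus> x \<otimes> y)"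
      using central_mult_right[OF ij(1) x, of b] central_mult_left_commute[OF ij(2) x y] i j carr y
      by simp
    then have "a \<otimes> b = (i \<oplus> j) \<oplus> x \<otimes> y" using carr x y by (simp add: add.m_assoc)
    moreover have "i \<oplus> j \<in> I" using subgroup.m_closed[OF I_sub i(1) j(1)] by simp
    ultimately have "a \<otimes> b \<in> I +> x \<otimes> y" by (auto simp: a_r_coset_def')
    then show ?thesis using add.repr_independence[OF _ _ I_sub] x y by simp
  qed
  moreover have "x \<in> I +> x" "y \<in> I +> y" using add.rcos_self[OF _ I_sub] x y by auto
  ultimately show ?thesis unfolding rcoset_mult_def by blast
qed

text \<open>
  The three differences are the error terms \<open>\<sigma>\<close>, \<open>\<alpha>\<close> and \<open>f\<close> of the introduction. For \<open>I = 0\<close> the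
  criterion identifies \<open>Z\<^sub>1(B)\<close> with the centre, for \<open>I = Z(B)\<close> it describes \<open>Z\<^sub>2(B)\<close>.
\<close>

lemma coset_in_quotient_centre_iff:
  assumes x: "x \<in> carrier B"
  shows "I +> x \<in> brace_centre (B Quot I) \<longleftrightarrow>
    (\<forall>b \<in> carrier B. x \<otimes> b \<ominus> (x \<oplus> b) \<in> I \<and> x \<oplus> b \<ominus> (b \<oplus> x) \<in> I \<and> x \<otimes> b \<ominus> b \<otimes> x \<in> I)"
proof -
  interpret N: normal I "add_monoid B" by (rule central_subgroup_normal)
  have "add_monoid (B Quot I) = add_monoid B Mod I"
    by (simp add: FactRing_def FactGroup_def A_RCOSETS_def set_add_def)
  then have group: "group (add_monoid (B Quot I))"
    using N.factorgroup_is_group by simp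
  have carrier: "carrier (B Quot I) = (\<lambda>b. I +> b) ` carrier B"
    by (auto simp: FactRing_def A_RCOSETS_def')
  have add: "(I +> a) \<oplus>\<^bsub>B Quot I\<^esub> (I +> b) = I +> a \<oplus> b" 
    if "a \<in> carrier B" "b \<in> carrier B" for a b
    using N.rcos_sum[of a b] that by (simp add: FactRing_def set_add_def a_r_coset_def)
  have mult: "(I +> a) \<otimes>\<^bsub>B Quot I\<^esub> (I +> b) = I +> a \<otimes> b" 
    if "a \<in> carrier B" "b \<in> carrier B" for a b
    using central_coset_mult[OF that] by (simp add: FactRing_def)
  have eq: "I +> a = I +> b \<longleftrightarrow> a \<ominus> b \<in> I" if "a \<in> carrier B" "b \<in> carrier B" for a b
  proof -
    have "I +> a = I +> b \<longleftrightarrow> a \<in> I +> b"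
      using add.repr_independence[OF _ that(2) I_sub, of a] add.rcos_self[OF that(1) I_sub] by blast
    also have "\<dots> \<longleftrightarrow> a \<ominus> b \<in> I"
      using N.rcos_module[OF add_group, of b a] that
      by (simp add: a_minus_def a_r_coset_def a_inv_def)
    finally show ?thesis .
  qed
  have closed: "mult (B Quot I) \<in> carrier (B Quot I) \<rightarrow> carrier (B Quot I) \<rightarrow> carrier (B Quot I)"
    by (auto simp: carrier mult)
  show ?thesis
    unfolding mem_brace_centre_iff[OF group closed] using x
    by (simp add: carrier add mult eq)
qed

end

lemma upper_central_1: "upper_central B (Suc 0) = brace_centre B"
proof (rule Set.set_eqI)
  fix x
  have "a \<ominus> b = \<zero> \<longleftrightarrow> a = b" if "a \<in> carrier B" "b \<in> carrier B" for a b
    using add.inv_solve_right'[of "\<zero>" a b] that by (simp add: a_minus_def)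
  then show "x \<in> upper_central B (Suc 0) \<longleftrightarrow> x \<in> brace_centre B"
    using coset_in_quotient_centre_iff[OF zero_subgroup_central, of x]
    by (cases "x \<in> carrier B") (simp_all add: mem_centre_iff)
qed

lemma mem_upper_central_2_iff:
  "z \<in> upper_central B 2 \<longleftrightarrow> z \<in> carrier B \<and> brace_centre B +> z \<in> brace_centre (B Quot brace_centre B)"
  unfolding numeral_2_eq_2 upper_central.simps(2)[of B "Suc 0"] upper_central_1 by simp

section \<open>Gruen's lemma\<close>

theorem second_centre_additive_conj_central:
  assumes perfect: "perfect_brace B"
    and z2: "z \<in> upper_central B 2"
    and conj_hom: "(\<lambda>x. z \<otimes> x \<otimes> inv z) \<in> hom (add_monoid B) (add_monoid B)"
  shows "z \<in> brace_centre B"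
proof -
  define f where "f b = z \<otimes> b \<ominus> b \<otimes> z" for b
  define \<alpha> where "\<alpha> b = z \<oplus> b \<ominus> (b \<oplus> z)" for b
  define \<sigma> where "\<sigma> b = z \<otimes> b \<ominus> (z \<oplus> b)" for b
  have z: "z \<in> carrier B" using z2 by (simp add: mem_upper_central_2_iff)
  have central: "f b \<in> brace_centre B" "\<alpha> b \<in> brace_centre B" "\<sigma> b \<in> brace_centre B"
    if "b \<in> carrier B" for b
    using z2 that
      coset_in_quotient_centre_iff[OF brace_centre_add_subgroup subset_refl z]
    by (simp_all add: mem_upper_central_2_iff f_def \<alpha>_def \<sigma>_def)
  note closed [simp] = central[THEN brace_centreD(1)]
  have split: "u = (u \<ominus> v) \<oplus> v" if "u \<in> carrier B" "v \<in> carrier B" for u v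
    using that by (simp add: a_minus_def add.m_assoc)
  have f: "z \<otimes> b = f b \<oplus> b \<otimes> z" and \<alpha>: "z \<oplus> b = \<alpha> b \<oplus> (b \<oplus> z)" and \<sigma>: "z \<otimes> b = \<sigma> b \<oplus> (z \<oplus> b)"
    if "b \<in> carrier B" for b
    unfolding f_def \<alpha>_def \<sigma>_def using that z by (intro split; simp)+
  have cancel: "u = v" if "u \<oplus> w = v \<oplus> w" "u \<in> carrier B" "v \<in> carrier B" "w \<in> carrier B" for u v w
    using add.right_cancel[of w u v] that by simp
  have float: "b \<oplus> (u \<oplus> c) = u \<oplus> (b \<oplus> c)" "b \<otimes> (u \<oplus> c) = u \<oplus> b \<otimes> c" "(u \<oplus> b) \<otimes> c = u \<oplus> b \<otimes> c"
    if "u \<in> brace_centre B" "b \<in> carrier B" "c \<in> carrier B" for u b c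
    using that central_add_left_commute central_mult_left_commute central_mult_right by auto

  (* First error term: f is multiplicative because z lies in the second centre, and additive by
     hypothesis. *)
  have conj: "z \<otimes> b \<otimes> inv z = f b \<oplus> b" if b: "b \<in> carrier B" for b
    using f[OF b] float(3)[OF central(1)[OF b], of "b \<otimes> z" "inv z"] z b by (simp add: mult.m_assoc)
  have f_add: "f (b \<oplus> c) = f b \<oplus> f c" if b: "b \<in> carrier B" and c: "c \<in> carrier B" for b c
  proof (rule cancel)
    have "f (b \<oplus> c) \<oplus> (b \<oplus> c) = f b \<oplus> b \<oplus> (f c \<oplus> c)"
      using hom_mult[OF conj_hom, of b c] conj b c by simp
    also have "\<dots> = f b \<oplus> f c \<oplus> (b \<oplus> c)"
      using float(1)[OF central(1)[OF c] b c] b c by (simp add: add.m_assoc)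
    finally show "f (b \<oplus> c) \<oplus> (b \<oplus> c) = f b \<oplus> f c \<oplus> (b \<oplus> c)" .
  qed (use b c in simp_all)
  have f_mult: "f (b \<otimes> c) = f b \<oplus> f c" if b: "b \<in> carrier B" and c: "c \<in> carrier B" for b c
  proof (rule cancel)
    have "f (b \<otimes> c) \<oplus> b \<otimes> c \<otimes> z = z \<otimes> b \<otimes> c"
      using f[of "b \<otimes> c"] z b c by (simp add: mult.m_assoc)
    also have "\<dots> = f b \<oplus> b \<otimes> (z \<otimes> c)"
      using f[OF b] float(3)[OF central(1)[OF b], of "b \<otimes> z" c] z b c by (simp add: mult.m_assoc)
    also have "\<dots> = f b \<oplus> f c \<oplus> b \<otimes> c \<otimes> z"
      using f[OF c] float(2)[OF central(1)[OF c] b, of "c \<otimes> z"] z b c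
      by (simp add: mult.m_assoc add.m_assoc)
    finally show "f (b \<otimes> c) \<oplus> b \<otimes> c \<otimes> z = f b \<oplus> f c \<oplus> b \<otimes> c \<otimes> z" .
  qed (use z b c in simp_all)
  have "f b = \<zero>" if "b \<in> carrier B" for b
    using perfect_central_map_zero[OF perfect central(1) f_add f_mult that] .
  then have commute: "z \<otimes> b = b \<otimes> z" if "b \<in> carrier B" for b
    using f that z by simp

  (* Second error term: b z - (b + z), which measures how far lambda_b moves z. *)
  have right: "b \<otimes> z = \<sigma> b \<oplus> \<alpha> b \<oplus> (b \<oplus> z)" if b: "b \<in> carrier B" for b
    using commute[OF b] \<sigma>[OF b] \<alpha>[OF b] z b by (simp add: add.m_assoc)
  have \<alpha>_add: "\<alpha> (b \<oplus> c) = \<alpha> b \<oplus> \<alpha> c" if b: "b \<in> carrier B" and c: "c \<in> carrier B" for b c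
  proof (rule cancel)
    have "\<alpha> (b \<oplus> c) \<oplus> (b \<oplus> c \<oplus> z) = z \<oplus> b \<oplus> c"
      using \<alpha>[of "b \<oplus> c"] z b c by (simp add: add.m_assoc)
    also have "\<dots> = \<alpha> b \<oplus> (b \<oplus> (z \<oplus> c))"
      using \<alpha>[OF b] z b c by (simp add: add.m_assoc)
    also have "\<dots> = \<alpha> b \<oplus> \<alpha> c \<oplus> (b \<oplus> c \<oplus> z)"
      using \<alpha>[OF c] float(1)[OF central(2)[OF c] b, of "c \<oplus> z"] z b c by (simp add: add.m_assoc)
    finally show "\<alpha> (b \<oplus> c) \<oplus> (b \<oplus> c \<oplus> z) = \<alpha> b \<oplus> \<alpha> c \<oplus> (b \<oplus> c \<oplus> z)" .
  qed (use z b c in simp_all)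
  have \<sigma>_add: "\<sigma> (b \<oplus> c) = \<sigma> b \<oplus> \<sigma> c" if b: "b \<in> carrier B" and c: "c \<in> carrier B" for b c
  proof (rule cancel)
    have "\<sigma> (b \<oplus> c) \<oplus> (z \<oplus> b \<oplus> c) = z \<otimes> b \<ominus> z \<oplus> z \<otimes> c"
      using \<sigma>[of "b \<oplus> c"] left_distrib[OF z b c] z b c by (simp add: add.m_assoc)
    also have "\<dots> = \<sigma> b \<oplus> (z \<oplus> b \<oplus> \<ominus> z \<oplus> (\<sigma> c \<oplus> (z \<oplus> c)))"
      using \<sigma>[OF b] \<sigma>[OF c] z b c by (simp add: add.m_assoc a_minus_def)
    also have "\<dots> = \<sigma> b \<oplus> (\<sigma> c \<oplus> (z \<oplus> b \<oplus> \<ominus> z \<oplus> (z \<oplus> c)))"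
      using float(1)[OF central(3)[OF c], of "z \<oplus> b \<oplus> \<ominus> z" "z \<oplus> c"] z b c by simp
    also have "z \<oplus> b \<oplus> \<ominus> z \<oplus> (z \<oplus> c) = z \<oplus> b \<oplus> c"
      using z b c by (simp add: add.m_assoc add.inv_solve_left')
    finally show "\<sigma> (b \<oplus> c) \<oplus> (z \<oplus> b \<oplus> c) = \<sigma> b \<oplus> \<sigma> c \<oplus> (z \<oplus> b \<oplus> c)"
      using z b c by (simp add: add.m_assoc)
  qed (use z b c in simp_all)
  define \<tau> where "\<tau> b = \<sigma> b \<oplus> \<alpha> b" for b
  have \<tau>_central: "\<tau> b \<in> brace_centre B" if "b \<in> carrier B" for b
    using subgroup.m_closed[OF brace_centre_add_subgroup central(3)[OF that] central(2)[OF that]]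
    by (simp add: \<tau>_def)
  note \<tau>_closed [simp] = \<tau>_central[THEN brace_centreD(1)]
  have \<tau>: "b \<otimes> z = \<tau> b \<oplus> (b \<oplus> z)" if "b \<in> carrier B" for b
    using right that by (simp add: \<tau>_def)
  have \<tau>_add: "\<tau> (b \<oplus> c) = \<tau> b \<oplus> \<tau> c" if b: "b \<in> carrier B" and c: "c \<in> carrier B" for b c
    using float(1)[OF central(2)[OF b] closed(3)[OF c] closed(2)[OF c]] \<alpha>_add[OF b c] \<sigma>_add[OF b c] b c
    by (simp add: \<tau>_def add.m_assoc)
  have distrib_z: "b \<otimes> (c \<oplus> z) = \<tau> b \<oplus> (b \<otimes> c \<oplus> z)" if b: "b \<in> carrier B" and c: "c \<in> carrier B" for b c
  proof -
    have "b \<otimes> (c \<oplus> z) = b \<otimes> c \<oplus> \<ominus> b \<oplus> (\<tau> b \<oplus> (b \<oplus> z))"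
      using left_distrib[OF b c z] \<tau>[OF b] by (simp add: a_minus_def)
    also have "\<dots> = \<tau> b \<oplus> (b \<otimes> c \<oplus> \<ominus> b \<oplus> (b \<oplus> z))"
      using float(1)[OF \<tau>_central[OF b], of "b \<otimes> c \<oplus> \<ominus> b" "b \<oplus> z"] z b c by simp
    also have "b \<otimes> c \<oplus> \<ominus> b \<oplus> (b \<oplus> z) = b \<otimes> c \<oplus> z"
      using z b c by (simp add: add.m_assoc add.inv_solve_left')
    finally show ?thesis .
  qed
  have \<tau>_mult: "\<tau> (b \<otimes> c) = \<tau> b \<oplus> \<tau> c" if b: "b \<in> carrier B" and c: "c \<in> carrier B" for b c
  proof (rule cancel)
    have "\<tau> (b \<otimes> c) \<oplus> (b \<otimes> c \<oplus> z) = b \<otimes> (c \<otimes> z)"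
      using \<tau>[of "b \<otimes> c"] z b c by (simp add: mult.m_assoc)
    also have "\<dots> = \<tau> c \<oplus> b \<otimes> (c \<oplus> z)"
      using \<tau>[OF c] float(2)[OF \<tau>_central[OF c] b, of "c \<oplus> z"] z b c by simp
    also have "\<dots> = \<tau> b \<oplus> \<tau> c \<oplus> (b \<otimes> c \<oplus> z)"
      using distrib_z[OF b c] float(1)[OF \<tau>_central[OF b] \<tau>_closed[OF c], of "b \<otimes> c \<oplus> z"] z b c
      by (simp add: add.m_assoc)
    finally show "\<tau> (b \<otimes> c) \<oplus> (b \<otimes> c \<oplus> z) = \<tau> b \<oplus> \<tau> c \<oplus> (b \<otimes> c \<oplus> z)" .
  qed (use z b c in simp_all)
  have \<tau>_zero: "\<tau> b = \<zero>" if "b \<in> carrier B" for b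
    using perfect_central_map_zero[OF perfect \<tau>_central \<tau>_add \<tau>_mult that] .

  (* Third error term: z + b c is computed by inserting b - b and using z + b = \<alpha> b + b z, which
     holds now that \<tau> vanishes; this brings in b (z + c), to which the brace axiom applies. *)
  have \<alpha>_mult: "\<alpha> (b \<otimes> c) = \<alpha> b \<oplus> \<alpha> c" if b: "b \<in> carrier B" and c: "c \<in> carrier B" for b c
  proof (rule cancel)
    have "\<alpha> (b \<otimes> c) \<oplus> (b \<otimes> c \<oplus> z) = z \<oplus> (b \<oplus> \<ominus> b \<oplus> b \<otimes> c)"
      using \<alpha>[of "b \<otimes> c"] z b c by simp
    also have "\<dots> = z \<oplus> b \<oplus> (\<ominus> b \<oplus> b \<otimes> c)"
      using z b c by (simp only: add.m_assoc add.inv_closed add.m_closed mult.m_closed)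
    also have "\<dots> = \<alpha> b \<oplus> (b \<otimes> z \<ominus> b \<oplus> b \<otimes> c)"
      using \<alpha>[OF b] \<tau>[OF b] \<tau>_zero[OF b] z b c by (simp add: add.m_assoc a_minus_def)
    also have "\<dots> = \<alpha> b \<oplus> b \<otimes> (z \<oplus> c)"
      using left_distrib[OF b z c] by simp
    also have "\<dots> = \<alpha> b \<oplus> (\<alpha> c \<oplus> b \<otimes> (c \<oplus> z))"
      using \<alpha>[OF c] float(2)[OF central(2)[OF c] b, of "c \<oplus> z"] z b c by simp
    also have "\<dots> = \<alpha> b \<oplus> \<alpha> c \<oplus> (b \<otimes> c \<oplus> z)"
      using distrib_z[OF b c] \<tau>_zero[OF b] z b c by (simp add: add.m_assoc)
    finally show "\<alpha> (b \<otimes> c) \<oplus> (b \<otimes> c \<oplus> z) = \<alpha> b \<oplus> \<alpha> c \<oplus> (b \<otimes> c \<oplus> z)" .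
  qed (use z b c in simp_all)
  have \<alpha>_zero: "\<alpha> b = \<zero>" if "b \<in> carrier B" for b
    using perfect_central_map_zero[OF perfect central(2) \<alpha>_add \<alpha>_mult that] .
  have \<sigma>_zero: "\<sigma> b = \<zero>" if "b \<in> carrier B" for b
    using \<tau>_zero[OF that] \<alpha>_zero[OF that] that by (simp add: \<tau>_def)
  show ?thesis
  proof (rule brace_centreI[OF z _ _ commute])
    fix b assume b: "b \<in> carrier B"
    show "z \<otimes> b = z \<oplus> b" using \<sigma>[OF b] \<sigma>_zero[OF b] z b by simp
    show "z \<oplus> b = b \<oplus> z" using \<alpha>[OF b] \<alpha>_zero[OF b] z b by simp
  qed
qed

end

text \<open>
  Left distributivity leaves a stray summand \<open>- z\<close> in \<open>z (x + y) = z x - z + z y\<close>. Right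
  distributivity sends it to \<open>(- z) z\<^sup>-\<^sup>1 = z\<^sup>-\<^sup>1 + z\<^sup>-\<^sup>1\<close>, which the two corrections \<open>- z\<^sup>-\<^sup>1\<close> cancel.
\<close>

lemma (in two_sided_skew_brace) conj_additive:
  assumes z: "z \<in> carrier B"
  shows "(\<lambda>x. z \<otimes> x \<otimes> inv z) \<in> hom (add_monoid B) (add_monoid B)"
proof -
  let ?w = "inv z"
  have neg: "\<ominus> z \<otimes> ?w = ?w \<oplus> ?w"
  proof -
    have "?w = (z \<oplus> \<ominus> z) \<otimes> ?w" using z by simp
    also have "\<dots> = \<ominus> ?w \<oplus> \<ominus> z \<otimes> ?w"
      using right_distrib[of ?w z "\<ominus> z"] z by (simp add: a_minus_def flip: zero_eq_one)
    finally show ?thesis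
      using add.inv_solve_left[of ?w ?w "\<ominus> z \<otimes> ?w"] z by simp
  qed
  have "z \<otimes> (x \<oplus> y) \<otimes> ?w = z \<otimes> x \<otimes> ?w \<oplus> z \<otimes> y \<otimes> ?w"
    if x: "x \<in> carrier B" and y: "y \<in> carrier B" for x y
  proof -
    have "z \<otimes> (x \<oplus> y) \<otimes> ?w = (z \<otimes> x \<oplus> (\<ominus> z \<oplus> z \<otimes> y)) \<otimes> ?w"
      using left_distrib[OF z x y] z x y by (simp add: a_minus_def add.m_assoc)
    also have "\<dots> = z \<otimes> x \<otimes> ?w \<ominus> ?w \<oplus> (\<ominus> z \<otimes> ?w \<ominus> ?w \<oplus> z \<otimes> y \<otimes> ?w)"
      using right_distrib[of ?w "z \<otimes> x" "\<ominus> z \<oplus> z \<otimes> y"] right_distrib[of ?w "\<ominus> z" "z \<otimes> y"] z x y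
      by simp
    also have "\<dots> = z \<otimes> x \<otimes> ?w \<oplus> z \<otimes> y \<otimes> ?w"
      using neg z x y by (simp add: a_minus_def add.m_assoc add.inv_solve_left')
    finally show ?thesis .
  qed
  then show ?thesis using z by (simp add: hom_def)
qed

theorem theorem1:
  fixes B (structure)
  assumes "skew_brace B"
    and "perfect_brace B"
  shows "(upper_central B 2 = brace_centre B \<longleftrightarrow>
            (\<forall>z \<in> upper_central B 2.
               (\<lambda>x. z \<otimes> x \<otimes> inv z) \<in> iso (add_monoid B) (add_monoid B)))
         \<and> (two_sided_skew_brace B \<longrightarrow>
              brace_centre (B Quot brace_centre B) = {\<zero>\<^bsub>B Quot brace_centre B\<^esub>})"
proof -
  interpret skew_brace B by (rule assms(1))
  let ?Z = "brace_centre B" and ?Q = "B Quot brace_centre B"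
  have Z_le: "?Z \<subseteq> upper_central B 2"
  proof
    fix z assume z: "z \<in> ?Z"
    have "\<zero> \<in> ?Z" using zero_subgroup_central(2) by simp
    moreover have "z \<otimes> b \<ominus> (z \<oplus> b) = \<zero>" "z \<oplus> b \<ominus> (b \<oplus> z) = \<zero>" "z \<otimes> b \<ominus> b \<otimes> z = \<zero>"
      if "b \<in> carrier B" for b
      using that brace_centreD(1)[OF z]
      by (simp_all add: a_minus_def brace_centreD(2,3)[OF z that] brace_centreD(4)[OF z that, symmetric])
    ultimately show "z \<in> upper_central B 2"
      using coset_in_quotient_centre_iff[OF brace_centre_add_subgroup subset_refl, of z]
        brace_centreD(1)[OF z]
      by (simp add: mem_upper_central_2_iff)
  qed
  have hom_imp_eq: "upper_central B 2 = ?Z"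
    if "\<And>z. z \<in> upper_central B 2 \<Longrightarrow> (\<lambda>x. z \<otimes> x \<otimes> inv z) \<in> hom (add_monoid B) (add_monoid B)"
    using second_centre_additive_conj_central[OF assms(2)] that Z_le by blast
  have conj_iso: "(\<lambda>x. z \<otimes> x \<otimes> inv z) \<in> iso (add_monoid B) (add_monoid B)" if z: "z \<in> ?Z" for z
  proof -
    have "z \<otimes> x \<otimes> inv z = x" if "x \<in> carrier B" for x
      using brace_centreD(1)[OF z] brace_centreD(4)[OF z that] that by (simp add: mult.m_assoc)
    then show ?thesis
      by (simp add: iso_def hom_def bij_betw_def inj_on_def)
  qed
  have trivial: "brace_centre ?Q = {\<zero>\<^bsub>?Q\<^esub>}" if eq: "upper_central B 2 = ?Z"
  proof -
    have zero_Q: "\<zero>\<^bsub>?Q\<^esub> = ?Z" by (simp add: FactRing_def)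
    have coset: "?Z +> z = ?Z" if "z \<in> ?Z" for z
      using add.coset_join2[OF _ brace_centre_add_subgroup that] brace_centreD(1)[OF that] by simp
    have "\<zero> \<in> ?Z" using zero_subgroup_central(2) by simp
    then have "?Z \<in> brace_centre ?Q"
      using mem_upper_central_2_iff[of "\<zero>"] eq coset[of "\<zero>"] by simp
    moreover have "brace_centre ?Q \<subseteq> {?Z}"
    proof
      fix C assume C: "C \<in> brace_centre ?Q"
      then obtain x where "x \<in> carrier B" "C = ?Z +> x"
        by (auto simp: brace_centre_def lambda_kernel_def FactRing_def A_RCOSETS_def')
      then have "x \<in> ?Z" using C eq mem_upper_central_2_iff[of x] by simp
      then show "C \<in> {?Z}" using coset \<open>C = ?Z +> x\<close> by simp
    qed
    ultimately show ?thesis unfolding zero_Q by (intro subset_antisym) simp_all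
  qed
  show ?thesis
  proof (intro conjI iffI ballI impI)
    fix z assume "upper_central B 2 = ?Z" "z \<in> upper_central B 2"
    then show "(\<lambda>x. z \<otimes> x \<otimes> inv z) \<in> iso (add_monoid B) (add_monoid B)"
      using conj_iso by simp
  next
    assume "\<forall>z \<in> upper_central B 2. (\<lambda>x. z \<otimes> x \<otimes> inv z) \<in> iso (add_monoid B) (add_monoid B)"
    then show "upper_central B 2 = ?Z"
      by (intro hom_imp_eq) (simp add: iso_def)
  next
    assume two_sided: "two_sided_skew_brace B"
    show "brace_centre ?Q = {\<zero>\<^bsub>?Q\<^esub>}"
    proof (intro trivial hom_imp_eq)
      fix z assume "z \<in> upper_central B 2"
      then have "z \<in> carrier B" by (simp add: mem_upper_central_2_iff)
      then show "(\<lambda>x. z \<otimes> x \<otimes> inv z) \<in> hom (add_monoid B) (add_monoid B)"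
        by (rule two_sided_skew_brace.conj_additive[OF two_sided])
    qed
  qed
qed

end
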